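(* Let $K$ be an extremally disconnected compact Hausdorff topological space and let $X$ be an order complete vector lattice which is (represented as) an order dense sublattice of $C^\infty(K)$. Put $$C=\bigl\{u\in C(K,[-\infty,\infty]) : u\ge f \text{ for some } f\in X\bigr\},$$ equipped with the pointwise partial order, pointwise multiplication by non-negative scalars (with $0\cdot(\pm\infty)=0$), and the following addition: for $u_1,u_2\in C$, the set $U=\{u_1>-\infty\}\cap\{u_2>-\infty\}$ is open and dense in $K$, and $u_1+u_2$ is the unique function in $C(K,[-\infty,\infty])$ with $(u_1+u_2)(t)=u_1(t)+u_2(t)$ for all $t\in U$. Then $C$ is a sup-completion of $X$.
   Context: $C(K,[-\infty,\infty])$ is the set of all continuous functions from $K$ to the extended real line $[-\infty,\infty]$, with the pointwise order. $C^\infty(K)$ is the vector lattice of all $f\in C(K,[-\infty,\infty])$ that are finite except on a nowhere dense set; scalar multiplication and lattice operations are pointwise, and $f+g$ is the unique $h\in C^\infty(K)$ such that $f(t),g(t)$ are finite and $h(t)=f(t)+g(t)$ for all $t$ in some open dense set. All vector lattices are Archimedean. A sublattice $X$ is order dense in $C^\infty(K)$ if for every $0<g\in C^\infty(K)$ there is $f\in X$ with $0<f\le g$. (By the Maeda-Ogasawara theorem every vector lattice can be represented as an order dense sublattice of such a $C^\infty(K)$; if it is order complete, it is then an ideal in $C^\infty(K)$.) Cone: a commutative semigroup with zero $(C,+,0)$ with a scalar multiplication $\mathbb R_+\times C\to C$ such that $\lambda(a+b)=\lambda a+\lambda b$, $(\lambda+\mu)a=\lambda a+\mu a$, $\lambda(\mu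 a)=(\lambda\mu)a$, $1a=a$, $0a=0$ for all $a,b\in C$, $\lambda,\mu\in\mathbb R_+$. Let $C_0$ be the set of all (additively) invertible elements of $C$; it is a group, and a real vector space with $(-r)x=-(rx)$ for $r>0$. Sup-completion: let $X$ be an order complete vector lattice. A cone $C$ is a sup-completion of $X$ if $C_0=X$ (with the same vector space operations and order) and the following hold: (1) $C$ has a partial order such that $a\le b$ implies $a+c\le b+c$ and $\lambda a\le\lambda b$ for all $a,b,c\in C$, $\lambda\in\mathbb R_+$; (2) $C$ is a lattice under this order; (3) $C$ has a greatest element; (4) if $x\in C_0$, $a\in C$ and $a\le x$, then $a\in C_0$; (5) every non-empty subset $A$ of $C$ has a supremum in $C$; if $A$ is bounded below then $\inf A$ exists in $C$; (6) $a=\sup\{x\in C_0 : x\le a\}$ for every $a\in C$; (7) $a+(x\wedge b)=(a+x)\wedge(a+b)$ for all $a,b\in C$, $x\in C_0$; (8) for any non-empty subsets $A,B$ of $C$ with $\sup A=\sup B$ and any $x\in C_0$, $\sup\{a\wedge x : a\in A\}=\sup\{b\wedge x : b\in B\}$ in $C$. *)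

theory Defs
  imports "HOL-Analysis.Analysis" "HOL-Algebra.Group"
begin

section \<open>Vector lattices and sup-completions\<close>

record 'a ordered_cone = "'a gorder" +
  add :: "'a \<Rightarrow> 'a \<Rightarrow> 'a"  (infixl \<open>\<oplus>\<index>\<close> 65)
  zero :: "'a"  (\<open>\<zero>\<index>\<close>)
  scale :: "real \<Rightarrow> 'a \<Rightarrow> 'a"  (infixr \<open>\<odot>\<index>\<close> 75)

definition add_part :: "('a, 'b) ordered_cone_scheme \<Rightarrow> 'a monoid" where
  "add_part V = \<lparr>carrier = carrier V, mult = add V, one = zero V\<rparr>"

locale vector_lattice = lattice V + add?: comm_group "add_part V" for V (structure) +
  assumes scale_closed: "x \<in> carrier V \<Longrightarrow> r \<odot> x \<in> carrier V"
    and scale_add_right: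
      "\<lbrakk>x \<in> carrier V; y \<in> carrier V\<rbrakk> \<Longrightarrow> r \<odot> (x \<oplus> y) = r \<odot> x \<oplus> r \<odot> y"
    and scale_add_left: "x \<in> carrier V \<Longrightarrow> (r + s) \<odot> x = r \<odot> x \<oplus> s \<odot> x"
    and scale_scale: "x \<in> carrier V \<Longrightarrow> r \<odot> s \<odot> x = (r * s) \<odot> x"
    and scale_one: "x \<in> carrier V \<Longrightarrow> 1 \<odot> x = x"
    and add_mono:
      "\<lbrakk>x \<in> carrier V; y \<in> carrier V; z \<in> carrier V; x \<sqsubseteq> y\<rbrakk> \<Longrightarrow> x \<oplus> z \<sqsubseteq> y \<oplus> z"
    and scale_mono:
      "\<lbrakk>x \<in> carrier V; y \<in> carrier V; 0 \<le> r; x \<sqsubseteq> y\<rbrakk> \<Longrightarrow> r \<odot> x \<sqsubseteq> r \<odot> y"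

text \<open>The Archimedean property is not listed: it follows from order completeness.\<close>

locale order_complete_vector_lattice = vector_lattice +
  assumes order_complete:
    "\<lbrakk>A \<subseteq> carrier V; A \<noteq> {}; Upper V A \<noteq> {}\<rbrakk> \<Longrightarrow> \<exists>s. is_lub V s A"

locale abstract_cone = add?: comm_monoid "add_part C" for C (structure) +
  assumes scale_closed: "\<lbrakk>a \<in> carrier C; 0 \<le> r\<rbrakk> \<Longrightarrow> r \<odot> a \<in> carrier C"
    and scale_add_right:
      "\<lbrakk>a \<in> carrier C; b \<in> carrier C; 0 \<le> r\<rbrakk> \<Longrightarrow> r \<odot> (a \<oplus> b) = r \<odot> a \<oplus> r \<odot> b"
    and scale_add_left:
      "\<lbrakk>a \<in> carrier C; 0 \<le> r; 0 \<le> s\<rbrakk> \<Longrightarrow> (r + s) \<odot> a = r \<odot> a \<oplus> s \<odot> a"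
    and scale_scale:
      "\<lbrakk>a \<in> carrier C; 0 \<le> r; 0 \<le> s\<rbrakk> \<Longrightarrow> r \<odot> s \<odot> a = (r * s) \<odot> a"
    and scale_one: "a \<in> carrier C \<Longrightarrow> 1 \<odot> a = a"
    and scale_zero: "a \<in> carrier C \<Longrightarrow> 0 \<odot> a = \<zero>"

text \<open>
  The invertible elements of a cone form a real vector space, where
  \<open>(- r) x = - (r x)\<close> for \<open>r > 0\<close>.  The scalar multiplication of the cone itself
  is only meaningful for non-negative scalars.
\<close>

definition invertible_part :: "'a ordered_cone \<Rightarrow> 'a ordered_cone" where
  "invertible_part C = C\<lparr>
     carrier := Units (add_part C),
     scale := (\<lambda>r x. if 0 \<le> r then r \<odot>\<^bsub>C\<^esub> x else inv\<^bsub>add_part C\<^esub> ((- r) \<odot>\<^bsub>C\<^esub> x))\<rparr>"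

text \<open>
  The operators \<open>\<sqinter>\<close> and \<open>\<Squnion>\<close> below are description operators.  They occur only where
  the meet exists because \<open>C\<close> is a lattice, or the supremum exists by
  \<open>sup_exists\<close>.
\<close>

locale sup_completion =
  base: order_complete_vector_lattice X + abstract_cone C + order: lattice C
  for X :: "'a ordered_cone" and C :: "'a ordered_cone" (structure) +
  fixes C0 :: "'a ordered_cone"
  defines C0_def: "C0 \<equiv> invertible_part C"
  assumes carrier_eq: "carrier C0 = carrier X"
    and zero_eq: "zero C0 = zero X"
    and add_eq:
      "\<lbrakk>x \<in> carrier X; y \<in> carrier X\<rbrakk> \<Longrightarrow> x \<oplus>\<^bsub>C0\<^esub> y = x \<oplus>\<^bsub>X\<^esub> y"
    and scale_eq: "x \<in> carrier X \<Longrightarrow> r \<odot>\<^bsub>C0\<^esub> x = r \<odot>\<^bsub>X\<^esub> x"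
    and le_eq:
      "\<lbrakk>x \<in> carrier X; y \<in> carrier X\<rbrakk> \<Longrightarrow> x \<sqsubseteq>\<^bsub>C0\<^esub> y \<longleftrightarrow> x \<sqsubseteq>\<^bsub>X\<^esub> y"
    and add_mono:
      "\<lbrakk>a \<in> carrier C; b \<in> carrier C; c \<in> carrier C; a \<sqsubseteq> b\<rbrakk> \<Longrightarrow> a \<oplus> c \<sqsubseteq> b \<oplus> c"
    and scale_mono:
      "\<lbrakk>a \<in> carrier C; b \<in> carrier C; 0 \<le> r; a \<sqsubseteq> b\<rbrakk> \<Longrightarrow> r \<odot> a \<sqsubseteq> r \<odot> b"
    and greatest_exists: "\<exists>m. greatest C m (carrier C)"
    and downward_closed:
      "\<lbrakk>x \<in> carrier C0; a \<in> carrier C; a \<sqsubseteq> x\<rbrakk> \<Longrightarrow> a \<in> carrier C0"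
    and sup_exists:
      "\<lbrakk>A \<subseteq> carrier C; A \<noteq> {}\<rbrakk> \<Longrightarrow> \<exists>s. is_lub C s A"
    and inf_exists:
      "\<lbrakk>A \<subseteq> carrier C; A \<noteq> {}; Lower C A \<noteq> {}\<rbrakk> \<Longrightarrow> \<exists>i. is_glb C i A"
    and sup_of_invertibles:
      "a \<in> carrier C \<Longrightarrow> is_lub C a {x \<in> carrier C0. x \<sqsubseteq> a}"
    and add_meet_distrib:
      "\<lbrakk>a \<in> carrier C; b \<in> carrier C; x \<in> carrier C0\<rbrakk>
        \<Longrightarrow> a \<oplus> (x \<sqinter> b) = (a \<oplus> x) \<sqinter> (a \<oplus> b)"
    and sup_meet_cong:
      "\<lbrakk>A \<subseteq> carrier C; A \<noteq> {}; B \<subseteq> carrier C; B \<noteq> {}; \<Squnion>A = \<Squnion>B; x \<in> carrier C0\<rbrakk>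
        \<Longrightarrow> \<Squnion>((\<lambda>a. a \<sqinter> x) ` A) = \<Squnion>((\<lambda>b. b \<sqinter> x) ` B)"


section \<open>Continuous extended real valued functions\<close>

definition Cinf :: "('k::topological_space \<Rightarrow> ereal) set" where
  "Cinf = {f. continuous_on UNIV f \<and> interior (closure {t. \<bar>f t\<bar> = \<infinity>}) = {}}"

definition Cinf_add ::
    "('k::topological_space \<Rightarrow> ereal) \<Rightarrow> ('k \<Rightarrow> ereal) \<Rightarrow> 'k \<Rightarrow> ereal" where
  "Cinf_add f g = (THE h. h \<in> Cinf \<and>
     (\<exists>D. open D \<and> closure D = UNIV \<and>
       (\<forall>t\<in>D. \<bar>f t\<bar> \<noteq> \<infinity> \<and> \<bar>g t\<bar> \<noteq> \<infinity> \<and> h t = f t + g t)))"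

text \<open>On \<open>ereal\<close>, \<open>0 * \<infinity> = 0 * (- \<infinity>) = 0\<close>, as required for scalar multiplication.\<close>

definition Cinf_space :: "('k::topological_space \<Rightarrow> ereal) ordered_cone" where
  "Cinf_space = \<lparr>carrier = Cinf, eq = (=), le = (\<le>),
     add = Cinf_add, zero = (\<lambda>_. 0), scale = (\<lambda>r f t. ereal r * f t)\<rparr>"

definition sublattice_of_Cinf :: "('k::topological_space \<Rightarrow> ereal) set \<Rightarrow> bool" where
  "sublattice_of_Cinf X \<longleftrightarrow> X \<subseteq> Cinf \<and> (\<lambda>_. 0) \<in> X \<and>
     (\<forall>f\<in>X. \<forall>g\<in>X. Cinf_add f g \<in> X \<and>
       (\<lambda>t. max (f t) (g t)) \<in> X \<and> (\<lambda>t. min (f t) (g t)) \<in> X) \<and>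
     (\<forall>r. \<forall>f\<in>X. (\<lambda>t. ereal r * f t) \<in> X)"

definition order_dense_in_Cinf :: "('k::topological_space \<Rightarrow> ereal) set \<Rightarrow> bool" where
  "order_dense_in_Cinf X \<longleftrightarrow>
     (\<forall>g\<in>Cinf. (\<lambda>_. 0) < g \<longrightarrow> (\<exists>f\<in>X. (\<lambda>_. 0) < f \<and> f \<le> g))"

definition upper_functions ::
    "('k::topological_space \<Rightarrow> ereal) set \<Rightarrow> ('k \<Rightarrow> ereal) set" where
  "upper_functions X = {u. continuous_on UNIV u \<and> (\<exists>f\<in>X. f \<le> u)}"

definition sum_domain ::
    "('k \<Rightarrow> ereal) \<Rightarrow> ('k \<Rightarrow> ereal) \<Rightarrow> 'k set" where
  "sum_domain u v = {t. u t > - \<infinity>} \<inter> {t. v t > - \<infinity>}"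

definition is_upper_sum ::
    "('k::topological_space \<Rightarrow> ereal) \<Rightarrow> ('k \<Rightarrow> ereal) \<Rightarrow> ('k \<Rightarrow> ereal) \<Rightarrow> bool" where
  "is_upper_sum u v h \<longleftrightarrow>
     continuous_on UNIV h \<and> (\<forall>t\<in>sum_domain u v. h t = u t + v t)"

definition upper_space ::
    "('k::topological_space \<Rightarrow> ereal) set \<Rightarrow> ('k \<Rightarrow> ereal) ordered_cone" where
  "upper_space X = \<lparr>carrier = upper_functions X, eq = (=), le = (\<le>),
     add = (\<lambda>u v. THE h. is_upper_sum u v h), zero = (\<lambda>_. 0),
     scale = (\<lambda>r u t. ereal r * u t)\<rparr>"

end

theory Submission
  imports Defs
begin

text \<open>
  Continuous extended real valued functions are compared on open dense sets, where the sums
  that matter are given by pointwise addition.  Extremal disconnectedness makes the closures of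
  the superlevel sets of a lower semicontinuous function clopen, so such a function has a least
  continuous majorant; this yields both the sums (extension from an open dense set) and the
  suprema.  The heart of the matter is that \<open>X\<close> is order convex among the continuous functions:
  if \<open>g\<close> lies between two elements of \<open>X\<close>, then \<open>g\<close> equals the supremum \<open>s\<close>, taken in \<open>X\<close>, of
  \<open>{x \<in> X. x \<le> g}\<close>, because by order density a positive part of \<open>s - g\<close> or \<open>g - s\<close> would dominate
  some \<open>x > 0\<close> in \<open>X\<close>, by which \<open>s\<close> could be decreased or increased.  Hence the invertible elements
  of the cone are exactly those of \<open>X\<close>.
\<close>

section \<open>Properties that hold on an open dense set\<close>

text \<open>A filter rather than an ad hoc predicate, so that \<open>eventually_elim\<close>
  combines finitely many conditions, each valid on its own open dense set.\<close>

definition generic :: "'k::topological_space filter" where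
  "generic = (INF D\<in>{D. open D \<and> closure D = UNIV}. principal D)"

lemma dense_Int_open:
  assumes "open D" "closure D = UNIV" "closure E = UNIV"
  shows "closure (D \<inter> E) = UNIV"
  using open_Int_closure_subset[OF assms(1), of E] assms
  by (metis closure_closure closure_mono inf_top_right top.extremum_unique)

lemma eventually_generic:
  "eventually P generic \<longleftrightarrow> (\<exists>D. open D \<and> closure D = UNIV \<and> (\<forall>t\<in>D. P t))"
proof -
  have "eventually P generic \<longleftrightarrow>
      (\<exists>D\<in>{D. open D \<and> closure D = UNIV}. eventually P (principal D))"
    unfolding generic_def
  proof (rule eventually_INF_base)
    show "{D::'a set. open D \<and> closure D = UNIV} \<noteq> {}"
      using open_UNIV closure_UNIV by blast
    fix a b :: "'a set"
    assume "a \<in> {D. open D \<and> closure D = UNIV}" "b \<in> {D. open D \<and> closure D = UNIV}"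
    then show "\<exists>x\<in>{D. open D \<and> closure D = UNIV}. principal x \<le> inf (principal a) (principal b)"
      by (intro bexI[of _ "a \<inter> b"]) (auto simp: dense_Int_open)
  qed
  then show ?thesis
    by (auto simp: eventually_principal)
qed

lemma eventually_genericI:
  "\<lbrakk>open D; closure D = UNIV; \<And>t. t \<in> D \<Longrightarrow> P t\<rbrakk> \<Longrightarrow> eventually P generic"
  by (auto simp: eventually_generic)

text \<open>The set where \<open>f t <= g t\<close> holds is closed, so it is everything once it
  contains a dense set. This turns pointwise arithmetic at good points into relations between
  functions.\<close>

lemma generic_le_imp_le:
  fixes f g :: "'k::topological_space \<Rightarrow> ereal"
  assumes f: "continuous_on UNIV f" and g: "continuous_on UNIV g"
    and le: "\<forall>\<^sub>F t in generic. f t \<le> g t"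
  shows "f \<le> g"
proof -
  obtain D where D: "closure D = UNIV" "D \<subseteq> {t. f t \<le> g t}"
    using le by (auto simp: eventually_generic)
  have "closure D \<subseteq> {t. f t \<le> g t}"
    using closed_Collect_le[OF f g] D(2) by (rule closure_minimal[rotated])
  with D(1) show ?thesis by (auto simp: le_fun_def)
qed

lemma generic_eq_imp_eq:
  fixes f g :: "'k::topological_space \<Rightarrow> ereal"
  assumes "continuous_on UNIV f" "continuous_on UNIV g" "\<forall>\<^sub>F t in generic. f t = g t"
  shows "f = g"
  by (intro antisym generic_le_imp_le assms eventually_mono[OF assms(3)]) auto

text \<open>The complement of the closure of a nowhere dense set is open and dense. This puts the
  finiteness condition of \<open>Cinf\<close> into the language of the filter.\<close>

lemma nowhere_dense_iff_generic:
  "interior (closure S) = {} \<longleftrightarrow> (\<forall>\<^sub>F t in generic. t \<notin> S)"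
proof
  assume "interior (closure S) = {}"
  then have "closure (- closure S) = UNIV"
    by (simp add: closure_complement)
  then show "\<forall>\<^sub>F t in generic. t \<notin> S"
    using closure_subset by (intro eventually_genericI[of "- closure S"]) auto
next
  assume "\<forall>\<^sub>F t in generic. t \<notin> S"
  then obtain D where D: "open D" "closure D = UNIV" "S \<subseteq> - D"
    by (auto simp: eventually_generic)
  have "closure S \<subseteq> - D"
    by (rule closure_minimal[OF D(3) closed_Compl[OF D(1)]])
  then have "interior (closure S) \<subseteq> interior (- D)"
    by (rule interior_mono)
  then show "interior (closure S) = {}"
    using D(2) by (simp add: interior_complement)
qed

lemma in_Cinf_iff:
  "f \<in> Cinf \<longleftrightarrow> continuous_on UNIV f \<and> (\<forall>\<^sub>F t in generic. \<bar>f t\<bar> \<noteq> \<infinity>)"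
  unfolding Cinf_def nowhere_dense_iff_generic by (simp only: mem_Collect_eq)

section \<open>Continuous functions on extremally disconnected spaces\<close>

lemma continuous_on_ereal_order:
  fixes s :: "'k::topological_space \<Rightarrow> ereal"
  assumes "\<And>c. open {t. c < s t}" "\<And>c. open {t. s t < c}"
  shows "continuous_on UNIV s"
  unfolding continuous_on_def
proof
  fix t
  have "(s \<longlongrightarrow> s t) (nhds t)"
  proof (rule order_tendstoI)
    fix c assume "c < s t"
    then show "\<forall>\<^sub>F x in nhds t. c < s x"
      using assms(1) by (auto simp: eventually_nhds)
  next
    fix c assume "s t < c"
    then show "\<forall>\<^sub>F x in nhds t. s x < c"
      using assms(2) by (auto simp: eventually_nhds)
  qed
  then show "(s \<longlongrightarrow> s t) (at t within UNIV)"
    using at_within_le_nhds tendsto_mono by blast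
qed

lemma continuous_on_If_clopen:
  assumes "open V" "closed V" "continuous_on UNIV f" "continuous_on UNIV g"
  shows "continuous_on UNIV (\<lambda>t. if t \<in> V then f t else g t)"
proof -
  have "continuous_on (V \<union> - V) (\<lambda>t. if t \<in> V then f t else g t)"
    using assms by (intro continuous_on_cases) (auto intro: continuous_on_subset)
  then show ?thesis by simp
qed

lemma continuous_on_scale_ereal:
  fixes f :: "'k::topological_space \<Rightarrow> ereal"
  assumes "continuous_on UNIV f"
  shows "continuous_on UNIV (\<lambda>t. ereal r * f t)"
  using assms by (auto simp: continuous_on_def intro: tendsto_cmult_ereal)

text \<open>
  For lower semicontinuous \<open>h\<close> on an extremally disconnected space this is the least continuous
  majorant of \<open>h\<close>.
\<close>

definition regularization :: "('k::topological_space \<Rightarrow> ereal) \<Rightarrow> 'k \<Rightarrow> ereal" where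
  "regularization h t = (SUP r\<in>{r. t \<in> closure {x. ereal r < h x}}. ereal r)"

lemma less_regularization_iff:
  "c < regularization h t \<longleftrightarrow> (\<exists>r. c < ereal r \<and> t \<in> closure {x. ereal r < h x})"
  by (auto simp: regularization_def less_SUP_iff)

lemma regularization_ge: "h \<le> regularization h"
proof (rule le_funI, rule ccontr)
  fix t assume "\<not> h t \<le> regularization h t"
  then obtain r where r: "regularization h t < ereal r" "ereal r < h t"
    by (meson ereal_dense2 not_le)
  then have "t \<in> closure {x. ereal r < h x}"
    by (intro subsetD[OF closure_subset]) simp
  then have "ereal r \<le> regularization h t"
    unfolding regularization_def by (intro SUP_upper) auto
  with r show False by simp
qed

text \<open>Being open, \<open>W\<close> misses the closure of every superlevel set that it misses,
  so an upper bound of \<open>h\<close> on \<open>W\<close> passes to the regularization. All upper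
  estimates below rest on this.\<close>

lemma regularization_le_on_open:
  assumes W: "open W" and le: "\<And>t. t \<in> W \<Longrightarrow> h t \<le> c" and t: "t \<in> W"
  shows "regularization h t \<le> c"
proof (rule ccontr)
  assume "\<not> regularization h t \<le> c"
  then obtain r where r: "c < ereal r" "t \<in> closure {x. ereal r < h x}"
    by (auto simp: not_le less_regularization_iff)
  have "W \<inter> {x. ereal r < h x} = {}"
    using le r(1) by force
  then have "W \<inter> closure {x. ereal r < h x} = {}"
    using open_Int_closure_eq_empty[OF W] by blast
  with t r(2) show False by blast
qed

lemma regularization_le:
  assumes g: "continuous_on UNIV g" and le: "h \<le> g"
  shows "regularization h \<le> g"
proof (rule le_funI, rule ccontr)
  fix t assume "\<not> regularization h t \<le> g t"
  then obtain r where r: "g t < r" "r < regularization h t"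
    by (meson dense not_le)
  \<comment> \<open>On this neighbourhood of \<open>t\<close> the function \<open>h\<close> is
    bounded by \<open>r\<close>, so the local estimate applies.\<close>
  have "open {x. g x < r}"
    by (intro open_Collect_less g continuous_intros)
  then have "regularization h t \<le> r"
    by (rule regularization_le_on_open)
      (use le r in \<open>auto simp: le_fun_def intro: order_trans[OF _ less_imp_le]\<close>)
  with r show False by simp
qed

text \<open>Preimages of open rays are unions of closures of superlevel sets, open by extremal
  disconnectedness, or unions of complements of such closures.\<close>

lemma continuous_on_regularization:
  fixes h :: "'k::topological_space \<Rightarrow> ereal"
  assumes ed: "\<forall>U :: 'k set. open U \<longrightarrow> open (closure U)"
    and lsc: "\<And>r. open {t. ereal r < h t}"
  shows "continuous_on UNIV (regularization h)"
proof (rule continuous_on_ereal_order)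
  fix c :: ereal
  have "{t. c < regularization h t} =
      (\<Union>r\<in>{r. c < ereal r}. closure {x. ereal r < h x})"
    by (auto simp: less_regularization_iff)
  then show "open {t. c < regularization h t}"
    using ed lsc by auto
  have "{t. regularization h t < c} =
      (\<Union>r\<in>{r. ereal r < c}. - closure {x. ereal r < h x})"
  proof (intro equalityI subsetI)
    fix t assume "t \<in> {t. regularization h t < c}"
    then obtain r where r: "regularization h t < ereal r" "ereal r < c"
      using ereal_dense2 by blast
    have "t \<notin> closure {x. ereal r < h x}"
    proof
      assume "t \<in> closure {x. ereal r < h x}"
      then have "ereal r \<le> regularization h t"
        unfolding regularization_def by (intro SUP_upper) auto
      with r(1) show False by simp
    qed
    with r(2) show "t \<in> (\<Union>r\<in>{r. ereal r < c}. - closure {x. ereal r < h x})"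
      by blast
  next
    fix t assume "t \<in> (\<Union>r\<in>{r. ereal r < c}. - closure {x. ereal r < h x})"
    then obtain r where r: "ereal r < c" "t \<in> - closure {x. ereal r < h x}" by blast
    have "open (- closure {x. ereal r < h x})" by auto
    moreover have "h x \<le> ereal r" if "x \<in> - closure {x. ereal r < h x}" for x
      using that closure_subset[of "{x. ereal r < h x}"] by (auto simp: not_less[symmetric])
    ultimately have "regularization h t \<le> ereal r"
      using r(2) by (rule regularization_le_on_open)
    with r(1) show "t \<in> {t. regularization h t < c}" by auto
  qed
  then show "open {t. regularization h t < c}" by auto
qed

text \<open>By continuity, \<open>h t < c\<close> persists on an open neighbourhood of
  \<open>t\<close> inside \<open>U\<close>, where the local estimate caps the regularization at
  \<open>c\<close>.\<close>

lemma regularization_eq_on_open: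
  fixes h :: "'k::topological_space \<Rightarrow> ereal"
  assumes U: "open U" and h: "continuous_on U h" and t: "t \<in> U"
  shows "regularization h t = h t"
proof (rule antisym)
  show "h t \<le> regularization h t"
    using regularization_ge[of h] by (simp add: le_fun_def)
  show "regularization h t \<le> h t"
  proof (rule dense_le)
    fix c assume c: "c < regularization h t"
    show "c \<le> h t"
    proof (rule ccontr)
      assume "\<not> c \<le> h t"
      then have ht: "h t < c" by simp
      have "open (h -` {..<c} \<inter> U)"
        using h U by (simp add: continuous_on_open_vimage)
      moreover have "h x \<le> c" if "x \<in> h -` {..<c} \<inter> U" for x
        using that by auto
      moreover have "t \<in> h -` {..<c} \<inter> U" using ht t by simp
      ultimately have "regularization h t \<le> c"
        by (rule regularization_le_on_open)
      with c show False by simp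
    qed
  qed
qed

lemma continuous_extension_ereal:
  fixes h :: "'k::topological_space \<Rightarrow> ereal"
  assumes ed: "\<forall>U :: 'k set. open U \<longrightarrow> open (closure U)"
    and U: "open U" and h: "continuous_on U h"
  shows "\<exists>H. continuous_on UNIV H \<and> (\<forall>t\<in>U. H t = h t)"
proof -
  \<comment> \<open>The default \<open>- \<infinity>\<close> keeps every superlevel set at a real
    level inside \<open>U\<close>, hence open, so the extension by it is lower
    semicontinuous.\<close>
  define h' where "h' t = (if t \<in> U then h t else - \<infinity>)" for t
  have cont: "continuous_on U h'"
    using h by (subst continuous_on_cong[OF refl, of U h' h]) (auto simp: h'_def)
  have "{t. ereal r < h' t} = h -` {ereal r<..} \<inter> U" for r
    by (auto simp: h'_def)
  then have "open {t. ereal r < h' t}" for r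
    using h U by (simp add: continuous_on_open_vimage)
  then have "continuous_on UNIV (regularization h')"
    by (intro continuous_on_regularization ed)
  moreover have "\<forall>t\<in>U. regularization h' t = h t"
    using regularization_eq_on_open[OF U cont] by (auto simp: h'_def)
  ultimately show ?thesis by blast
qed

text \<open>The pointwise supremum is lower semicontinuous but need not be continuous; its
  regularization is the least continuous majorant.\<close>

lemma continuous_supremum:
  fixes A :: "('k::topological_space \<Rightarrow> ereal) set"
  assumes ed: "\<forall>U :: 'k set. open U \<longrightarrow> open (closure U)"
    and A: "\<And>a. a \<in> A \<Longrightarrow> continuous_on UNIV a"
  shows "\<exists>s. continuous_on UNIV s \<and> (\<forall>a\<in>A. a \<le> s) \<and>
    (\<forall>u. continuous_on UNIV u \<longrightarrow> (\<forall>a\<in>A. a \<le> u) \<longrightarrow> s \<le> u)"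
proof -
  define h where "h t = (SUP a\<in>A. a t)" for t
  have "{t. ereal r < h t} = (\<Union>a\<in>A. {t. ereal r < a t})" for r
    by (auto simp: h_def less_SUP_iff)
  then have "open {t. ereal r < h t}" for r
    using A by (auto intro!: open_UN open_Collect_less continuous_intros)
  then have "continuous_on UNIV (regularization h)"
    by (intro continuous_on_regularization ed)
  moreover have "\<forall>a\<in>A. a \<le> regularization h"
    by (intro ballI order_trans[OF _ regularization_ge] le_funI)
      (auto simp: h_def intro: SUP_upper)
  moreover have "regularization h \<le> u" if "continuous_on UNIV u" "\<forall>a\<in>A. a \<le> u" for u
    using that by (intro regularization_le) (auto simp: h_def le_fun_def intro: SUP_least)
  ultimately show ?thesis by blast
qed

section \<open>Addition\<close>

text \<open>A common domain for addition, containing both \<open>Cinf\<close> and the upper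
  functions, so that sums in the two settings are treated at once.\<close>

definition lower_finite :: "('k::topological_space \<Rightarrow> ereal) set" where
  "lower_finite = {u. continuous_on UNIV u \<and> (\<forall>\<^sub>F t in generic. u t \<noteq> - \<infinity>)}"

definition upper_sum ::
    "('k::topological_space \<Rightarrow> ereal) \<Rightarrow> ('k \<Rightarrow> ereal) \<Rightarrow> 'k \<Rightarrow> ereal" where
  "upper_sum u v = (THE h. is_upper_sum u v h)"

lemma Cinf_subset_lower_finite: "Cinf \<subseteq> lower_finite"
  by (auto simp: in_Cinf_iff lower_finite_def elim!: eventually_mono)

lemma lower_finite_mono:
  assumes "f \<in> lower_finite" "continuous_on UNIV u" "f \<le> u"
  shows "u \<in> lower_finite"
proof -
  have "\<forall>\<^sub>F t in generic. f t \<noteq> - \<infinity>"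
    using assms(1) by (simp add: lower_finite_def)
  then have "\<forall>\<^sub>F t in generic. u t \<noteq> - \<infinity>"
    by (rule eventually_mono) (use assms(3) in \<open>metis le_funD ereal_infty_less_eq(2)\<close>)
  with assms(2) show ?thesis by (simp add: lower_finite_def)
qed

lemma lower_finite_dense:
  assumes "u \<in> lower_finite"
  shows "open {t. u t > - \<infinity>}" "closure {t. u t > - \<infinity>} = UNIV"
proof -
  show "open {t. u t > - \<infinity>}"
    using assms by (intro open_Collect_less continuous_on_const) (simp add: lower_finite_def)
  obtain D where D: "closure D = UNIV" "\<forall>t\<in>D. u t \<noteq> - \<infinity>"
    using assms by (auto simp: lower_finite_def eventually_generic)
  then have "D \<subseteq> {t. u t > - \<infinity>}" by auto
  then show "closure {t. u t > - \<infinity>} = UNIV"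
    using D(1) closure_mono by blast
qed

lemma sum_domain_dense:
  assumes "u \<in> lower_finite" "v \<in> lower_finite"
  shows "open (sum_domain u v)" "closure (sum_domain u v) = UNIV"
  unfolding sum_domain_def
  by (intro open_Int dense_Int_open lower_finite_dense assms)+

lemma generic_sum_domain:
  assumes "u \<in> lower_finite" "v \<in> lower_finite"
  shows "\<forall>\<^sub>F t in generic. t \<in> sum_domain u v"
  using sum_domain_dense[OF assms] by (rule eventually_genericI)

lemma is_upper_sum_unique:
  assumes "u \<in> lower_finite" "v \<in> lower_finite" "is_upper_sum u v g" "is_upper_sum u v h"
  shows "g = h"
  using assms(3,4)
  by (intro generic_eq_imp_eq eventually_mono[OF generic_sum_domain[OF assms(1,2)]])
    (auto simp: is_upper_sum_def)

text \<open>Addition on \<open>ereal\<close> is continuous at pairs avoiding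
  \<open>- \<infinity>\<close>, so the pointwise sum is continuous on the open set
  \<open>sum_domain u v\<close> and extends from there.\<close>

lemma is_upper_sum_exists:
  fixes u v :: "'k::topological_space \<Rightarrow> ereal"
  assumes ed: "\<forall>U :: 'k set. open U \<longrightarrow> open (closure U)"
    and uv: "u \<in> lower_finite" "v \<in> lower_finite"
  shows "\<exists>h. is_upper_sum u v h"
proof -
  have "continuous_on (sum_domain u v) (\<lambda>t. u t + v t)"
    unfolding continuous_on_def
  proof
    fix t assume "t \<in> sum_domain u v"
    moreover have "continuous_on (sum_domain u v) u" "continuous_on (sum_domain u v) v"
      using uv by (auto simp: lower_finite_def intro: continuous_on_subset)
    ultimately show "((\<lambda>t. u t + v t) \<longlongrightarrow> u t + v t) (at t within sum_domain u v)"
      by (intro tendsto_add_ereal_nonneg) (auto simp: sum_domain_def continuous_on_def)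
  qed
  from continuous_extension_ereal[OF ed sum_domain_dense(1)[OF uv] this]
  show ?thesis by (auto simp: is_upper_sum_def)
qed

text \<open>The generic formula also records that both summands avoid \<open>- \<infinity>\<close>,
  so later pointwise arithmetic never meets \<infinity> - \<infinity>.\<close>

lemma upper_sum:
  fixes u v :: "'k::topological_space \<Rightarrow> ereal"
  assumes ed: "\<forall>U :: 'k set. open U \<longrightarrow> open (closure U)"
    and uv: "u \<in> lower_finite" "v \<in> lower_finite"
  shows continuous_on_upper_sum: "continuous_on UNIV (upper_sum u v)"
    and generic_upper_sum:
      "\<forall>\<^sub>F t in generic. u t \<noteq> - \<infinity> \<and> v t \<noteq> - \<infinity> \<and> upper_sum u v t = u t + v t"
    and upper_sum_lower_finite: "upper_sum u v \<in> lower_finite"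
proof -
  have *: "is_upper_sum u v (upper_sum u v)"
    unfolding upper_sum_def
    using is_upper_sum_exists[OF ed uv] is_upper_sum_unique[OF uv] by (metis theI)
  then show c: "continuous_on UNIV (upper_sum u v)"
    by (simp add: is_upper_sum_def)
  show g: "\<forall>\<^sub>F t in generic. u t \<noteq> - \<infinity> \<and> v t \<noteq> - \<infinity> \<and> upper_sum u v t = u t + v t"
    using * by (intro eventually_mono[OF generic_sum_domain[OF uv]])
      (auto simp: is_upper_sum_def sum_domain_def)
  show "upper_sum u v \<in> lower_finite"
    using c g by (auto simp: lower_finite_def elim!: eventually_mono)
qed

lemma upper_sum_eqI:
  fixes u v w :: "'k::topological_space \<Rightarrow> ereal"
  assumes ed: "\<forall>U :: 'k set. open U \<longrightarrow> open (closure U)"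
    and uv: "u \<in> lower_finite" "v \<in> lower_finite" and w: "continuous_on UNIV w"
    and eq: "\<forall>\<^sub>F t in generic. w t = u t + v t"
  shows "upper_sum u v = w"
  using generic_upper_sum[OF ed uv] eq
  by (intro generic_eq_imp_eq w continuous_on_upper_sum[OF ed uv]) (auto elim: eventually_elim2)

text \<open>Both additions extend the pointwise sum continuously from an open dense set, and such an
  extension is unique. Hence the cone induces on \<open>X\<close> the addition that \<open>X\<close>
  already has.\<close>

lemma upper_sum_Cinf:
  fixes f g :: "'k::topological_space \<Rightarrow> ereal"
  assumes ed: "\<forall>U :: 'k set. open U \<longrightarrow> open (closure U)"
    and fg: "f \<in> Cinf" "g \<in> Cinf"
  shows "upper_sum f g \<in> Cinf" "Cinf_add f g = upper_sum f g"
proof -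
  have lf: "f \<in> lower_finite" "g \<in> lower_finite"
    using fg Cinf_subset_lower_finite by auto
  note s = upper_sum[OF ed lf]
  have fin: "\<forall>\<^sub>F t in generic. \<bar>f t\<bar> \<noteq> \<infinity> \<and> \<bar>g t\<bar> \<noteq> \<infinity> \<and> upper_sum f g t = f t + g t"
    using fg s(2) by (auto simp: in_Cinf_iff eventually_conj_iff elim: eventually_mono)
  then have "\<forall>\<^sub>F t in generic. \<bar>upper_sum f g t\<bar> \<noteq> \<infinity>"
    by (rule eventually_mono) auto
  with s(1) show mem: "upper_sum f g \<in> Cinf"
    by (simp add: in_Cinf_iff)
  show "Cinf_add f g = upper_sum f g"
    unfolding Cinf_add_def
  proof (rule the_equality)
    show "upper_sum f g \<in> Cinf \<and> (\<exists>D. open D \<and> closure D = UNIV \<and>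
        (\<forall>t\<in>D. \<bar>f t\<bar> \<noteq> \<infinity> \<and> \<bar>g t\<bar> \<noteq> \<infinity> \<and> upper_sum f g t = f t + g t))"
      using mem fin unfolding eventually_generic by blast
    fix h assume h: "h \<in> Cinf \<and> (\<exists>D. open D \<and> closure D = UNIV \<and>
        (\<forall>t\<in>D. \<bar>f t\<bar> \<noteq> \<infinity> \<and> \<bar>g t\<bar> \<noteq> \<infinity> \<and> h t = f t + g t))"
    then have "\<forall>\<^sub>F t in generic. h t = f t + g t"
      unfolding eventually_generic by blast
    with h show "h = upper_sum f g"
      by (intro upper_sum_eqI[OF ed lf, symmetric]) (auto simp: in_Cinf_iff)
  qed
qed


section \<open>Order dense sublattices\<close>

locale order_dense_sublattice =
  fixes X :: "('k::topological_space \<Rightarrow> ereal) set"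
  assumes extremally_disconnected: "\<forall>U :: 'k set. open U \<longrightarrow> open (closure U)"
    and order_complete: "order_complete_vector_lattice (Cinf_space\<lparr>carrier := X\<rparr>)"
    and sublattice: "sublattice_of_Cinf X"
    and order_dense: "order_dense_in_Cinf X"
begin

section \<open>Closure properties of \<open>X\<close> and of the upper functions\<close>

abbreviation C :: "('k \<Rightarrow> ereal) set" where
  "C \<equiv> upper_functions X"

lemmas upper_sum_facts = upper_sum[OF extremally_disconnected]

lemma X_subset_Cinf: "X \<subseteq> Cinf"
  and zero_in_X: "(\<lambda>_. 0) \<in> X"
  and min_in_X: "f \<in> X \<Longrightarrow> g \<in> X \<Longrightarrow> (\<lambda>t. min (f t) (g t)) \<in> X"
  and scale_in_X: "f \<in> X \<Longrightarrow> (\<lambda>t. ereal r * f t) \<in> X"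
  using sublattice by (auto simp: sublattice_of_Cinf_def)

lemma X_generic_finite: "f \<in> X \<Longrightarrow> \<forall>\<^sub>F t in generic. \<bar>f t\<bar> \<noteq> \<infinity>"
  and X_continuous: "f \<in> X \<Longrightarrow> continuous_on UNIV f"
  using X_subset_Cinf by (auto simp: in_Cinf_iff)

lemma X_lower_finite: "f \<in> X \<Longrightarrow> f \<in> lower_finite"
  using X_subset_Cinf Cinf_subset_lower_finite by blast

lemma sum_in_X:
  assumes "f \<in> X" "g \<in> X"
  shows "upper_sum f g \<in> X"
  using upper_sum_Cinf(2)[OF extremally_disconnected, of f g] assms sublattice X_subset_Cinf
  by (metis sublattice_of_Cinf_def subsetD)

lemma C_continuous: "u \<in> C \<Longrightarrow> continuous_on UNIV u"
  by (auto simp: upper_functions_def)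

lemma X_subset_C: "X \<subseteq> C"
  using X_continuous by (auto simp: upper_functions_def)

lemma C_lower_finite: "u \<in> C \<Longrightarrow> u \<in> lower_finite"
  using lower_finite_mono X_lower_finite by (auto simp: upper_functions_def)

lemma C_mono: "u \<in> C \<Longrightarrow> continuous_on UNIV v \<Longrightarrow> u \<le> v \<Longrightarrow> v \<in> C"
  by (auto simp: upper_functions_def intro: order_trans)

lemma upper_sum_mono:
  fixes u v u' v' :: "'k \<Rightarrow> ereal"
  assumes "u \<in> lower_finite" "v \<in> lower_finite" "u' \<in> lower_finite" "v' \<in> lower_finite"
    and "u \<le> u'" "v \<le> v'"
  shows "upper_sum u v \<le> upper_sum u' v'"
proof (rule generic_le_imp_le)
  show "continuous_on UNIV (upper_sum u v)" "continuous_on UNIV (upper_sum u' v')"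
    by (rule upper_sum_facts(1)[OF assms(1,2)] upper_sum_facts(1)[OF assms(3,4)])+
  show "\<forall>\<^sub>F t in generic. upper_sum u v t \<le> upper_sum u' v' t"
    using upper_sum_facts(2)[OF assms(1,2)] upper_sum_facts(2)[OF assms(3,4)]
    by eventually_elim (use assms(5,6) in \<open>auto simp: le_fun_def intro: add_mono\<close>)
qed

lemma sum_in_C:
  assumes "u \<in> C" "v \<in> C"
  shows "upper_sum u v \<in> C"
proof -
  obtain f g where fg: "f \<in> X" "g \<in> X" "f \<le> u" "g \<le> v"
    using assms by (auto simp: upper_functions_def)
  have "upper_sum f g \<le> upper_sum u v"
    by (intro upper_sum_mono fg C_lower_finite X_lower_finite assms)
  then show ?thesis
    using sum_in_X[OF fg(1,2)] X_subset_C upper_sum_facts(1) C_lower_finite assms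
    by (blast intro: C_mono)
qed

text \<open>Used with \<open>r\<close> equal to 1 or -1 to move a function up or down by an element
  \<open>x\<close> of \<open>X\<close>; the finiteness of \<open>x t\<close> allows
  \<open>x t\<close> to be cancelled afterwards.\<close>

lemma generic_upper_sum_scale:
  assumes "u \<in> lower_finite" "x \<in> X"
  shows "\<forall>\<^sub>F t in generic. upper_sum u (\<lambda>t. ereal r * x t) t = u t + ereal r * x t
    \<and> u t \<noteq> - \<infinity> \<and> \<bar>x t\<bar> \<noteq> \<infinity>"
  using upper_sum_facts(2)[OF assms(1) X_lower_finite[OF scale_in_X[OF assms(2)]]]
    X_generic_finite[OF assms(2)]
  by eventually_elim auto

section \<open>Order convexity of \<open>X\<close>\<close>

lemma X_supremum:
  assumes "A \<subseteq> X" "A \<noteq> {}" "h \<in> X" "\<And>a. a \<in> A \<Longrightarrow> a \<le> h"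
  shows "\<exists>s\<in>X. (\<forall>a\<in>A. a \<le> s) \<and> (\<forall>u\<in>X. (\<forall>a\<in>A. a \<le> u) \<longrightarrow> s \<le> u)"
proof -
  let ?V = "Cinf_space\<lparr>carrier := X\<rparr>"
  interpret V: order_complete_vector_lattice ?V by (rule order_complete)
  have "h \<in> Upper ?V A"
    using assms by (auto simp: Upper_def Cinf_space_def)
  then obtain s where "is_lub ?V s A"
    using V.order_complete[of A] assms(1,2) by (auto simp: Cinf_space_def)
  then have "s \<in> X" "\<forall>a\<in>A. a \<le> s" "\<forall>u\<in>X. (\<forall>a\<in>A. a \<le> u) \<longrightarrow> s \<le> u"
    using assms(1) by (auto simp: least_def Upper_def Cinf_space_def)
  then show ?thesis by blast
qed

text \<open>If the positive part of \<open>s - g\<close> in \<open>Cinf\<close> vanished,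
  \<open>s <= g\<close> would hold on an open dense set. So it is positive, and order density puts
  some \<open>x\<close> below it. The bound is only generic because \<open>s - g\<close> is read
  pointwise where both are finite.\<close>

lemma order_dense_gap:
  assumes s: "s \<in> Cinf" and g: "g \<in> Cinf" and not_le: "\<not> s \<le> g"
  shows "\<exists>x\<in>X. (\<lambda>_. 0) < x \<and> (\<forall>\<^sub>F t in generic. x t \<le> max 0 (s t - g t))"
proof -
  define n where "n t = ereal (- 1) * g t" for t
  have n: "n \<in> Cinf"
    using g by (auto simp: n_def in_Cinf_iff intro: continuous_on_scale_ereal elim: eventually_mono)
  define d where "d = upper_sum s n"
  have d: "d \<in> Cinf"
    unfolding d_def by (intro upper_sum_Cinf extremally_disconnected s n)
  have lf: "s \<in> lower_finite" "n \<in> lower_finite"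
    using s n Cinf_subset_lower_finite by auto
  have fin: "\<forall>\<^sub>F t in generic. \<bar>s t\<bar> \<noteq> \<infinity>" "\<forall>\<^sub>F t in generic. \<bar>g t\<bar> \<noteq> \<infinity>"
    using s g by (auto simp: in_Cinf_iff)
  have d_eq: "\<forall>\<^sub>F t in generic. d t = s t - g t \<and> \<bar>s t\<bar> \<noteq> \<infinity> \<and> \<bar>g t\<bar> \<noteq> \<infinity>"
    using upper_sum_facts(2)[OF lf] fin
    by eventually_elim (auto simp: d_def n_def minus_ereal_def)
  define p where "p t = max 0 (d t)" for t
  have p: "p \<in> Cinf"
    using d by (auto simp: p_def in_Cinf_iff max_def elim: eventually_mono
        intro!: continuous_on_max[unfolded max_def] continuous_intros)
  have "p \<noteq> (\<lambda>_. 0)"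
  proof
    assume "p = (\<lambda>_. 0)"
    then have le: "d t \<le> 0" for t
      unfolding p_def fun_eq_iff by (metis max.cobounded2)
    have "\<forall>\<^sub>F t in generic. s t \<le> g t"
      using d_eq
    proof eventually_elim
      case (elim t)
      with le[of t] show ?case by (cases "s t"; cases "g t") auto
    qed
    with not_le s g show False
      using generic_le_imp_le[of s g] by (simp add: in_Cinf_iff)
  qed
  then have "(\<lambda>_. 0) < p"
    by (auto simp: less_le p_def le_fun_def)
  then obtain x where x: "x \<in> X" "(\<lambda>_. 0) < x" "x \<le> p"
    using order_dense p by (auto simp: order_dense_in_Cinf_def)
  have "\<forall>\<^sub>F t in generic. x t \<le> max 0 (s t - g t)"
    using d_eq by eventually_elim (use le_funD[OF x(3)] in \<open>metis p_def\<close>)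
  with x show ?thesis by blast
qed

text \<open>The common end of the gap arguments: moving a supremum by \<open>x\<close> forces
  \<open>x\<close> to be nonpositive on an open dense set.\<close>

lemma not_generic_nonpos:
  assumes x: "x \<in> X" "(\<lambda>_. 0) < x" and le: "\<forall>\<^sub>F t in generic. x t \<le> 0"
  shows False
proof -
  have "x \<le> (\<lambda>_. 0)"
    by (intro generic_le_imp_le X_continuous x zero_in_X le)
  with x(2) show False by simp
qed

text \<open>The two bounds make \<open>g\<close> generically finite, hence a member of
  \<open>Cinf\<close>, where order density can be used.\<close>

lemma X_order_convex:
  assumes g: "continuous_on UNIV g" and f: "f \<in> X" "f \<le> g" and h: "h \<in> X" "g \<le> h"
  shows "g \<in> X"
proof -
  have gC: "g \<in> Cinf"
    unfolding in_Cinf_iff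
  proof
    show "\<forall>\<^sub>F t in generic. \<bar>g t\<bar> \<noteq> \<infinity>"
      using X_generic_finite[OF f(1)] X_generic_finite[OF h(1)]
    proof eventually_elim
      case (elim t)
      moreover have "f t \<le> g t" "g t \<le> h t"
        using f h by (auto simp: le_fun_def)
      ultimately show ?case by (cases "f t"; cases "h t"; cases "g t") auto
    qed
  qed (fact g)
  let ?A = "{x \<in> X. x \<le> g}"
  have "?A \<subseteq> X" "?A \<noteq> {}" "\<And>a. a \<in> ?A \<Longrightarrow> a \<le> h"
    using f h(2) by (auto intro: order_trans)
  \<comment> \<open>Here \<open>s\<close> is least only among upper bounds in \<open>X\<close>, so
    even \<open>s <= g\<close> requires an argument.\<close>
  then obtain s where s: "s \<in> X" "\<And>a. a \<in> X \<Longrightarrow> a \<le> g \<Longrightarrow> a \<le> s"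
    "\<And>u. u \<in> X \<Longrightarrow> (\<And>a. a \<in> X \<Longrightarrow> a \<le> g \<Longrightarrow> a \<le> u) \<Longrightarrow> s \<le> u"
    using X_supremum[of ?A h] h(1) by auto
  have sC: "s \<in> Cinf"
    using s(1) X_subset_Cinf by blast
  have fin: "\<forall>\<^sub>F t in generic. \<bar>g t\<bar> \<noteq> \<infinity> \<and> \<bar>s t\<bar> \<noteq> \<infinity>"
    using gC sC by (simp add: in_Cinf_iff eventually_conj_iff)
  have "s \<le> g"
  proof (rule ccontr)
    assume "\<not> s \<le> g"
    then obtain x where x: "x \<in> X" "(\<lambda>_. 0) < x"
      "\<forall>\<^sub>F t in generic. x t \<le> max 0 (s t - g t)"
      using order_dense_gap[OF sC gC] by blast
    \<comment> \<open>Still an upper bound: where \<open>s > g\<close>, the bound on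
      \<open>x\<close> gives \<open>s - x >= g >= a\<close>; elsewhere \<open>x <= 0\<close> and
      \<open>s - x >= s >= a\<close>.\<close>
    define y where "y = upper_sum s (\<lambda>t. ereal (- 1) * x t)"
    have y: "y \<in> X"
      unfolding y_def by (intro sum_in_X s scale_in_X x)
    note y_eq = generic_upper_sum_scale[OF X_lower_finite[OF s(1)] x(1), of "- 1", folded y_def]
    have "s \<le> y"
    proof (rule s(3)[OF y])
      fix a assume a: "a \<in> X" "a \<le> g"
      have "\<forall>\<^sub>F t in generic. a t \<le> y t"
        using y_eq x(3) fin
      proof eventually_elim
        case (elim t)
        moreover have "a t \<le> s t" "a t \<le> g t"
          using s(2)[OF a] a(2) by (auto simp: le_fun_def)
        ultimately show ?case
          by (cases "s t"; cases "g t"; cases "x t"; cases "a t") (auto simp: max_def split: if_splits)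
      qed
      then show "a \<le> y"
        by (intro generic_le_imp_le X_continuous a y)
    qed
    have "\<forall>\<^sub>F t in generic. x t \<le> 0"
      using y_eq fin
    proof eventually_elim
      case (elim t)
      moreover have "s t \<le> y t" using \<open>s \<le> y\<close> by (simp add: le_fun_def)
      ultimately show ?case by (cases "s t"; cases "x t") auto
    qed
    with x(1,2) show False by (rule not_generic_nonpos)
  qed
  moreover have "g \<le> s"
  proof (rule ccontr)
    assume "\<not> g \<le> s"
    then obtain x where x: "x \<in> X" "(\<lambda>_. 0) < x"
      "\<forall>\<^sub>F t in generic. x t \<le> max 0 (g t - s t)"
      using order_dense_gap[OF gC sC] by blast
    \<comment> \<open>Since \<open>s <= g\<close> is now known, \<open>x\<close> is at most
      \<open>g - s\<close>, so \<open>s + x\<close> remains below \<open>g\<close> and thus below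
      \<open>s\<close>. The factor 1 only fits the form of
      \<open>generic_upper_sum_scale\<close>.\<close>
    define y where "y = upper_sum s (\<lambda>t. ereal 1 * x t)"
    have y: "y \<in> X"
      unfolding y_def by (intro sum_in_X s scale_in_X x)
    note y_eq = generic_upper_sum_scale[OF X_lower_finite[OF s(1)] x(1), of 1, folded y_def]
    have "\<forall>\<^sub>F t in generic. y t \<le> g t"
      using y_eq x(3) fin
    proof eventually_elim
      case (elim t)
      moreover have "s t \<le> g t"
        using \<open>s \<le> g\<close> by (simp add: le_fun_def)
      ultimately show ?case
        by (cases "s t"; cases "g t"; cases "x t") (auto simp: max_def split: if_splits)
    qed
    then have "y \<le> s"
      by (intro s(2) y generic_le_imp_le X_continuous g)
    have "\<forall>\<^sub>F t in generic. x t \<le> 0"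
      using y_eq fin
    proof eventually_elim
      case (elim t)
      moreover have "y t \<le> s t" using \<open>y \<le> s\<close> by (simp add: le_fun_def)
      ultimately show ?case by (cases "s t"; cases "x t") auto
    qed
    with x(1,2) show False by (rule not_generic_nonpos)
  qed
  ultimately have "g = s" by (rule antisym[rotated])
  with s(1) show ?thesis by simp
qed

section \<open>Suprema of upper functions\<close>

lemma C_supremum:
  assumes "A \<subseteq> C" "A \<noteq> {}"
  shows "\<exists>s\<in>C. (\<forall>a\<in>A. a \<le> s) \<and> (\<forall>u\<in>C. (\<forall>a\<in>A. a \<le> u) \<longrightarrow> s \<le> u)"
proof -
  obtain s where s: "continuous_on UNIV s" "\<forall>a\<in>A. a \<le> s"
    "\<forall>u. continuous_on UNIV u \<longrightarrow> (\<forall>a\<in>A. a \<le> u) \<longrightarrow> s \<le> u"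
    using continuous_supremum[OF extremally_disconnected, of A] assms(1) C_continuous by blast
  \<comment> \<open>As \<open>A\<close> is nonempty, \<open>s\<close> dominates some upper function
    and so an element of \<open>X\<close>.\<close>
  have "s \<in> C"
    using s(1,2) assms C_mono by blast
  with s show ?thesis using C_continuous by blast
qed

lemma C_eq_supremum_X:
  assumes a: "a \<in> C" and u: "u \<in> C" and ub: "\<And>x. x \<in> X \<Longrightarrow> x \<le> a \<Longrightarrow> x \<le> u"
  shows "a \<le> u"
proof -
  \<comment> \<open>If the supremum \<open>s\<close> were smaller than \<open>a\<close>, a clopen set \<open>V\<close> with a gap between \<open>s\<close> and \<open>a\<close>
    would give \<open>x > 0\<close> in \<open>X\<close> whose addition preserves \<open>{x \<in> X. x \<le> a}\<close>, so \<open>s - x\<close> would be an upper bound.\<close>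
  let ?A = "{x \<in> X. x \<le> a}"
  have "?A \<noteq> {}" "?A \<subseteq> C"
    using a X_subset_C by (auto simp: upper_functions_def)
  then obtain s where s: "s \<in> C" "\<And>x. x \<in> X \<Longrightarrow> x \<le> a \<Longrightarrow> x \<le> s"
    "\<And>w. w \<in> C \<Longrightarrow> (\<And>x. x \<in> X \<Longrightarrow> x \<le> a \<Longrightarrow> x \<le> w) \<Longrightarrow> s \<le> w"
    using C_supremum[of ?A] by auto
  have "s \<le> a" using a by (intro s(3)) auto
  have "a \<le> s"
  proof (rule ccontr)
    assume "\<not> a \<le> s"
    then obtain t0 where t0: "s t0 < a t0"
      by (auto simp: le_fun_def not_le)
    obtain q where q: "s t0 < ereal q" "ereal q < a t0"
      using ereal_dense2[OF t0] by blast
    obtain r where r: "ereal q < ereal r" "ereal r < a t0"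
      using ereal_dense2[OF q(2)] by blast
    define W where "W = {t. s t < ereal q} \<inter> {t. ereal r < a t}"
    have W: "open W" "t0 \<in> W"
      unfolding W_def using q r
      by (auto intro!: open_Collect_less C_continuous s a continuous_intros)
    define V where "V = closure W"
    have V: "open V" "closed V" "t0 \<in> V"
      using W closure_subset[of W] by (auto simp: V_def extremally_disconnected)
    have sq: "s t \<le> ereal q" and ra: "ereal r \<le> a t" if "t \<in> V" for t
    proof -
      have "V \<subseteq> {t. s t \<le> ereal q} \<inter> {t. ereal r \<le> a t}"
        unfolding V_def
        by (intro closure_minimal closed_Int closed_Collect_le C_continuous s a continuous_intros)
          (auto simp: W_def)
      with that show "s t \<le> ereal q" "ereal r \<le> a t" by auto
    qed
    \<comment> \<open>Continuous because \<open>V\<close> is clopen; this is the finite positive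
      function to which order density applies.\<close>
    define p where "p t = (if t \<in> V then ereal (r - q) else 0)" for t
    have "p \<in> Cinf"
      unfolding in_Cinf_iff p_def
      by (intro conjI continuous_on_If_clopen V continuous_on_const always_eventually) auto
    moreover have "(\<lambda>_. 0) < p"
      unfolding less_fun_def using V(3) r(1) by (auto simp: le_fun_def p_def not_le)
    ultimately obtain x where x: "x \<in> X" "(\<lambda>_. 0) < x" "x \<le> p"
      using order_dense by (auto simp: order_dense_in_Cinf_def)
    define w where "w = upper_sum s (\<lambda>t. ereal (- 1) * x t)"
    have w: "w \<in> C"
      unfolding w_def using X_subset_C scale_in_X[OF x(1)] by (blast intro: sum_in_C s)
    note w_eq = generic_upper_sum_scale[OF C_lower_finite[OF s(1)] x(1), of "- 1", folded w_def]
    have x_le: "x t \<le> (if t \<in> V then ereal (r - q) else 0)" for t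
      using x(3) by (simp add: le_fun_def p_def)
    have "s \<le> w"
    proof (rule s(3)[OF w])
      fix y assume y: "y \<in> X" "y \<le> a"
      \<comment> \<open>On \<open>V\<close>, \<open>y <= s <= q\<close> and
        \<open>x <= r - q\<close> give \<open>y + x <= r <= a\<close>; off \<open>V\<close>,
        \<open>x <= 0\<close>. Hence \<open>y + x\<close> competes in the supremum, and
        \<open>y + x <= s\<close> yields \<open>y <= s - x\<close>.\<close>
      define z where "z = upper_sum y (\<lambda>t. ereal 1 * x t)"
      have z: "z \<in> X"
        unfolding z_def by (intro sum_in_X y scale_in_X x)
      note z_eq = generic_upper_sum_scale[OF X_lower_finite[OF y(1)] x(1), of 1, folded z_def]
      have "y \<le> s" using s(2) y by blast
      have "\<forall>\<^sub>F t in generic. z t \<le> a t"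
        using z_eq
      proof eventually_elim
        case (elim t)
        have yt: "y t \<le> s t" "y t \<le> a t" using \<open>y \<le> s\<close> y(2) by (auto simp: le_fun_def)
        show ?case
        proof (cases "t \<in> V")
          case True
          have "y t \<le> ereal q" using yt(1) sq[OF True] by (rule order_trans)
          then have "y t + x t \<le> ereal q + ereal (r - q)"
            using x_le[of t] True by (intro add_mono) auto
          also have "\<dots> \<le> a t" using ra[OF True] by simp
          finally show ?thesis using elim by simp
        next
          case False
          have "y t + x t \<le> a t + 0"
            using x_le[of t] False yt(2) by (intro add_mono) auto
          then show ?thesis using elim by simp
        qed
      qed
      then have "z \<le> s"
        by (intro s(2) z generic_le_imp_le X_continuous C_continuous a)
      have "\<forall>\<^sub>F t in generic. y t \<le> w t"
        using z_eq w_eq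
      proof eventually_elim
        case (elim t)
        moreover have "z t \<le> s t" using \<open>z \<le> s\<close> by (simp add: le_fun_def)
        ultimately show ?case by (cases "s t"; cases "y t"; cases "x t") auto
      qed
      then show "y \<le> w"
        by (intro generic_le_imp_le X_continuous C_continuous y w)
    qed
    have "\<forall>\<^sub>F t in generic. x t \<le> 0"
      using w_eq
    proof eventually_elim
      case (elim t)
      show ?case
      proof (cases "t \<in> V")
        case True
        \<comment> \<open>On \<open>V\<close> the value \<open>s t\<close> is at most
          \<open>q\<close> and generically not \<open>- \<infinity>\<close>, so it is finite and
          cancels from \<open>s <= s - x\<close>.\<close>
        moreover have "s t \<le> w t" using \<open>s \<le> w\<close> by (simp add: le_fun_def)
        ultimately show ?thesis
          using elim sq[OF True] by (cases "s t"; cases "x t") auto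
      next
        case False
        then show ?thesis using x_le[of t] by simp
      qed
    qed
    with x(1,2) show False by (rule not_generic_nonpos)
  qed
  also have "s \<le> u" using u ub by (rule s(3))
  finally show ?thesis .
qed

text \<open>Where \<open>u < q < x\<close>, the bound on the meet of \<open>a\<close> and
  \<open>x\<close> forces \<open>a <= u < q\<close> for every \<open>a\<close> in \<open>A\<close>,
  so the least upper bound \<open>s\<close> cannot exceed \<open>q\<close> there.\<close>

lemma meet_supremum_le:
  assumes A: "A \<subseteq> C" "A \<noteq> {}" and x: "x \<in> C" and u: "u \<in> C"
    and s: "\<And>w. w \<in> C \<Longrightarrow> (\<And>a. a \<in> A \<Longrightarrow> a \<le> w) \<Longrightarrow> s \<le> w"
    and sC: "s \<in> C" "\<And>a. a \<in> A \<Longrightarrow> a \<le> s"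
    and ub: "\<And>a. a \<in> A \<Longrightarrow> inf a x \<le> u"
  shows "inf s x \<le> u"
proof (rule ccontr)
  assume "\<not> inf s x \<le> u"
  then obtain t0 where t0: "u t0 < min (s t0) (x t0)"
    by (auto simp: le_fun_def not_le inf_min)
  obtain q where q: "u t0 < q" "q < s t0" "q < x t0"
    using dense[OF t0] by auto
  define W where "W = {t. u t < q} \<inter> {t. q < x t}"
  have W: "open W" "t0 \<in> W"
    unfolding W_def using q
    by (auto intro!: open_Collect_less C_continuous x u continuous_intros)
  define V where "V = closure W"
  have V: "open V" "closed V" "t0 \<in> V"
    using W closure_subset[of W] by (auto simp: V_def extremally_disconnected)
  \<comment> \<open>Cutting \<open>s\<close> down to \<open>q\<close> on \<open>V\<close> leaves a smaller continuous upper bound of \<open>A\<close>.\<close>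
  define w where "w t = (if t \<in> V then min (s t) q else s t)" for t
  have w_cont: "continuous_on UNIV w"
    unfolding w_def min_def
    by (intro continuous_on_If_clopen V continuous_on_min[unfolded min_def] C_continuous sC
        continuous_on_const)
  have le_w: "a \<le> w" if "a \<in> A" for a
  proof -
    have "closed {t. a t \<le> q}"
      using that A(1) by (intro closed_Collect_le C_continuous continuous_intros) auto
    moreover have "W \<subseteq> {t. a t \<le> q}"
    proof
      fix t assume "t \<in> W"
      then have "u t < q" "q < x t" by (auto simp: W_def)
      moreover have "min (a t) (x t) \<le> u t"
        using ub[OF that] by (simp add: le_fun_def inf_min)
      ultimately show "t \<in> {t. a t \<le> q}" by (auto simp: min_def split: if_splits)
    qed
    ultimately have "V \<subseteq> {t. a t \<le> q}"
      unfolding V_def by (intro closure_minimal)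
    then show ?thesis
      using sC(2)[OF that] by (auto simp: le_fun_def w_def)
  qed
  have "w \<in> C"
    using A le_w w_cont C_mono by blast
  then have "s \<le> w"
    using le_w by (rule s)
  then have "s t0 \<le> w t0" by (simp add: le_fun_def)
  with V(3) q(2) show False by (auto simp: w_def)
qed

section \<open>Cone and lattice structure of the upper functions\<close>

abbreviation S :: "('k \<Rightarrow> ereal) ordered_cone" where
  "S \<equiv> upper_space X"

lemma upper_space_simps [simp]:
  "carrier S = C" "eq S = (=)" "le S = (\<le>)" "add S = upper_sum" "zero S = (\<lambda>_. 0)"
  "scale S r u = (\<lambda>t. ereal r * u t)"
  by (auto simp: upper_space_def upper_sum_def fun_eq_iff)

lemma zero_in_C: "(\<lambda>_. 0) \<in> C"
  using zero_in_X X_subset_C by blast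

lemma inf_in_C:
  assumes "u \<in> C" "v \<in> C"
  shows "inf u v \<in> C"
proof -
  obtain f g where fg: "f \<in> X" "g \<in> X" "f \<le> u" "g \<le> v"
    using assms by (auto simp: upper_functions_def)
  show ?thesis
  proof (rule C_mono)
    show "(\<lambda>t. min (f t) (g t)) \<in> C"
      using min_in_X fg X_subset_C by blast
    show "continuous_on UNIV (inf u v)"
      using assms by (simp add: inf_fun_def inf_min continuous_on_min C_continuous)
    show "(\<lambda>t. min (f t) (g t)) \<le> inf u v"
      using fg(3,4) by (auto simp: le_fun_def inf_min intro: min.coboundedI1 min.coboundedI2)
  qed
qed

lemma scale_in_C:
  assumes "u \<in> C" "0 \<le> r"
  shows "(\<lambda>t. ereal r * u t) \<in> C"
proof -
  obtain f where f: "f \<in> X" "f \<le> u"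
    using assms(1) by (auto simp: upper_functions_def)
  show ?thesis
  proof (rule C_mono)
    show "(\<lambda>t. ereal r * f t) \<in> C"
      using scale_in_X[OF f(1)] X_subset_C by blast
    show "continuous_on UNIV (\<lambda>t. ereal r * u t)"
      by (intro continuous_on_scale_ereal C_continuous assms)
    show "(\<lambda>t. ereal r * f t) \<le> (\<lambda>t. ereal r * u t)"
      using f(2) assms(2) by (auto simp: le_fun_def intro: ereal_mult_left_mono)
  qed
qed

lemma generic_sum_C:
  assumes "u \<in> C" "v \<in> C"
  shows "\<forall>\<^sub>F t in generic. u t \<noteq> - \<infinity> \<and> v t \<noteq> - \<infinity> \<and> upper_sum u v t = u t + v t"
  by (intro upper_sum_facts C_lower_finite assms)

lemma upper_sum_C_eqI:
  assumes "u \<in> C" "v \<in> C" "w \<in> C" "\<forall>\<^sub>F t in generic. w t = u t + v t"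
  shows "upper_sum u v = w"
  by (intro upper_sum_eqI[OF extremally_disconnected] C_lower_finite C_continuous assms)

lemma upper_sum_assoc:
  assumes "u \<in> C" "v \<in> C" "w \<in> C"
  shows "upper_sum (upper_sum u v) w = upper_sum u (upper_sum v w)"
proof (rule upper_sum_C_eqI)
  show "\<forall>\<^sub>F t in generic. upper_sum u (upper_sum v w) t = upper_sum u v t + w t"
    using generic_sum_C[OF assms(1,2)] generic_sum_C[OF assms(2,3)]
      generic_sum_C[OF assms(1) sum_in_C[OF assms(2,3)]]
    by eventually_elim (auto simp: add.assoc)
qed (intro sum_in_C assms)+

lemma upper_sum_commute: "upper_sum u v = upper_sum v u"
  by (simp add: upper_sum_def is_upper_sum_def sum_domain_def add.commute Int_commute)

lemma comm_monoid_C: "comm_monoid (add_part S)"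
proof (unfold_locales, goal_cases)
  case (1 x y) then show ?case by (simp add: add_part_def sum_in_C)
next
  case (2 x y z) then show ?case by (simp add: add_part_def upper_sum_assoc)
next
  case 3 show ?case by (simp add: add_part_def zero_in_C)
next
  case (4 x) then show ?case
    by (auto simp: add_part_def intro!: upper_sum_C_eqI zero_in_C)
next
  case (5 x) then show ?case
    by (auto simp: add_part_def intro!: upper_sum_C_eqI zero_in_C)
next
  case (6 x y) show ?case by (simp add: add_part_def upper_sum_commute[of x])
qed

lemma abstract_cone_C: "abstract_cone S"
proof (intro abstract_cone.intro abstract_cone_axioms.intro comm_monoid_C, goal_cases)
  case (1 a r) then show ?case by (simp add: scale_in_C)
next
  case (2 a b r)
  then have ab: "a \<in> C" "b \<in> C" and r: "0 \<le> r" by auto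
  have "upper_sum (\<lambda>t. ereal r * a t) (\<lambda>t. ereal r * b t) = (\<lambda>t. ereal r * upper_sum a b t)"
  proof (rule upper_sum_C_eqI)
    show "\<forall>\<^sub>F t in generic. ereal r * upper_sum a b t = ereal r * a t + ereal r * b t"
      using generic_sum_C[OF ab]
    proof eventually_elim
      case (elim t)
      then show ?case using r by (cases "a t"; cases "b t") (auto simp: algebra_simps)
    qed
  qed (intro scale_in_C sum_in_C ab r)+
  then show ?case by simp
next
  case (3 a r s)
  then have a: "a \<in> C" and rs: "0 \<le> r" "0 \<le> s" by auto
  have "upper_sum (\<lambda>t. ereal r * a t) (\<lambda>t. ereal s * a t) = (\<lambda>t. ereal (r + s) * a t)"
  proof (rule upper_sum_C_eqI)
    \<comment> \<open>For nonnegative \<open>r\<close> and \<open>s\<close> this holds at infinite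
      values too, so no passage to a dense set is required.\<close>
    have "ereal (r + s) * a t = ereal r * a t + ereal s * a t" for t
      using rs by (cases "a t") (auto simp: algebra_simps)
    then show "\<forall>\<^sub>F t in generic. ereal (r + s) * a t = ereal r * a t + ereal s * a t"
      by simp
  qed (use a rs in \<open>auto intro: scale_in_C\<close>)
  then show ?case by simp
next
  case (4 a r s)
  show ?case by (simp add: mult.assoc[symmetric])
next
  case (5 a) show ?case by (simp add: one_ereal_def[symmetric])
next
  case (6 a) show ?case by (simp add: zero_ereal_def[symmetric])
qed

lemma is_lub_S_iff:
  assumes "A \<subseteq> C"
  shows "is_lub S s A \<longleftrightarrow> s \<in> C \<and> (\<forall>a\<in>A. a \<le> s) \<and> (\<forall>u\<in>C. (\<forall>a\<in>A. a \<le> u) \<longrightarrow> s \<le> u)"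
proof -
  have "Upper S A = {u \<in> C. \<forall>a\<in>A. a \<le> u}"
    using assms by (auto simp: Upper_def)
  then show ?thesis by (simp add: least_def) blast
qed

lemma is_glb_S_iff:
  assumes "A \<subseteq> C"
  shows "is_glb S s A \<longleftrightarrow> s \<in> C \<and> (\<forall>a\<in>A. s \<le> a) \<and> (\<forall>u\<in>C. (\<forall>a\<in>A. u \<le> a) \<longrightarrow> u \<le> s)"
proof -
  have "Lower S A = {u \<in> C. \<forall>a\<in>A. u \<le> a}"
    using assms by (auto simp: Lower_def)
  then show ?thesis by (simp add: greatest_def) blast
qed

lemma partial_order_S: "partial_order S"
  by unfold_locales auto

lemma lub_S_exists: "A \<subseteq> C \<Longrightarrow> A \<noteq> {} \<Longrightarrow> \<exists>s. is_lub S s A"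
  using C_supremum[of A] by (auto simp: is_lub_S_iff)

text \<open>The infimum is the supremum of the set \<open>L\<close> of lower bounds, each member of
  \<open>A\<close> being an upper bound of \<open>L\<close>.\<close>

lemma glb_S_exists:
  assumes "A \<subseteq> C" "A \<noteq> {}" "Lower S A \<noteq> {}"
  shows "\<exists>i. is_glb S i A"
proof -
  define L where "L = {l \<in> C. \<forall>a\<in>A. l \<le> a}"
  have L: "L \<subseteq> C" "L \<noteq> {}"
    using assms(1,3) by (auto simp: L_def Lower_def)
  then obtain i where i: "i \<in> C" "\<And>l. l \<in> L \<Longrightarrow> l \<le> i"
    "\<And>u. u \<in> C \<Longrightarrow> (\<And>l. l \<in> L \<Longrightarrow> l \<le> u) \<Longrightarrow> i \<le> u"
    using C_supremum[of L] by blast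
  have "i \<le> a" if "a \<in> A" for a
    using that assms(1) by (intro i(3)) (auto simp: L_def)
  with i(1,2) show ?thesis
    unfolding is_glb_S_iff[OF assms(1)] by (intro exI[of _ i]) (simp add: L_def)
qed

lemma is_glb_inf: "u \<in> C \<Longrightarrow> v \<in> C \<Longrightarrow> is_glb S (inf u v) {u, v}"
  by (auto simp: is_glb_S_iff inf_in_C)

lemma lattice_S: "lattice S"
proof -
  interpret partial_order S by (rule partial_order_S)
  show ?thesis
  proof (unfold_locales, goal_cases)
    case (1 x y) then show ?case using lub_S_exists[of "{x, y}"] by simp
  next
    case (2 x y) then show ?case using is_glb_inf[of x y] by auto
  qed
qed

text \<open>Antisymmetry makes the choice in the supremum operator unique, so it may be replaced by
  any known least upper bound.\<close>

lemma lub_S_eq: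
  assumes "A \<subseteq> C" "is_lub S s A"
  shows "\<Squnion>\<^bsub>S\<^esub>A = s"
  unfolding sup_def using assms by (intro some_equality) (auto simp: is_lub_S_iff intro: antisym)

lemma meet_S_eq:
  assumes "u \<in> C" "v \<in> C"
  shows "u \<sqinter>\<^bsub>S\<^esub> v = inf u v"
  unfolding meet_def Lattice.inf_def using is_glb_inf[OF assms] assms
  by (intro some_equality) (auto simp: is_glb_S_iff intro: antisym)

section \<open>Invertible elements of the cone\<close>

lemma upper_sum_neg:
  assumes "x \<in> X"
  shows "upper_sum x (\<lambda>t. ereal (- 1) * x t) = (\<lambda>_. 0)"
proof (rule upper_sum_C_eqI)
  show "\<forall>\<^sub>F t in generic. 0 = x t + ereal (- 1) * x t"
    using X_generic_finite[OF assms]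
  proof eventually_elim
    case (elim t)
    then show ?case by (cases "x t") auto
  qed
qed (use assms X_subset_C scale_in_X[OF assms] zero_in_C in auto)

text \<open>Elements of \<open>X\<close> are inverted by negation. Conversely, if
  \<open>u + v = 0\<close>, lower bounds \<open>f <= u\<close> and \<open>g <= v\<close> from
  \<open>X\<close> sandwich \<open>u\<close> between \<open>f\<close> and \<open>- g\<close>, and
  order convexity applies.\<close>

lemma Units_S: "Units (add_part S) = X"
proof
  show "X \<subseteq> Units (add_part S)"
  proof
    fix x assume x: "x \<in> X"
    then show "x \<in> Units (add_part S)"
      using X_subset_C scale_in_X[OF x, of "- 1"] upper_sum_neg[OF x]
        upper_sum_commute[of "\<lambda>t. ereal (- 1) * x t" x]
      unfolding Units_def add_part_def by (auto intro!: bexI[of _ "\<lambda>t. ereal (- 1) * x t"])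
  qed
  show "Units (add_part S) \<subseteq> X"
  proof
    fix u assume "u \<in> Units (add_part S)"
    then obtain v where uv: "u \<in> C" "v \<in> C" "upper_sum u v = (\<lambda>_. 0)"
      by (auto simp: Units_def add_part_def)
    obtain f g where fg: "f \<in> X" "g \<in> X" "f \<le> u" "g \<le> v"
      using uv by (auto simp: upper_functions_def)
    have "\<forall>\<^sub>F t in generic. u t \<le> ereal (- 1) * g t"
      using generic_sum_C[OF uv(1,2)] X_generic_finite[OF fg(2)]
    proof eventually_elim
      case (elim t)
      moreover have "g t \<le> v t" using fg(4) by (simp add: le_fun_def)
      ultimately show ?case
        using uv(3) by (cases "u t"; cases "v t"; cases "g t") auto
    qed
    then have "u \<le> (\<lambda>t. ereal (- 1) * g t)"
      by (intro generic_le_imp_le C_continuous uv X_continuous scale_in_X fg)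
    then show "u \<in> X"
      using fg(1,3) scale_in_X[OF fg(2)] C_continuous[OF uv(1)] by (blast intro: X_order_convex)
  qed
qed

text \<open>For negative \<open>r\<close> the cone only offers the inverse of
  \<open>(- r) x\<close>, which is \<open>r x\<close> by uniqueness of inverses.\<close>

lemma scale_invertible_part:
  assumes "x \<in> X"
  shows "scale (invertible_part S) r x = (\<lambda>t. ereal r * x t)"
proof (cases "0 \<le> r")
  case True
  then show ?thesis by (simp add: invertible_part_def)
next
  case False
  interpret comm_monoid "add_part S" by (rule comm_monoid_C)
  let ?y = "\<lambda>t. ereal (- r) * x t"
  have y: "?y \<in> X" using scale_in_X[OF assms] .
  have eq: "(\<lambda>t. ereal (- 1) * ?y t) = (\<lambda>t. ereal r * x t)"
  proof
    fix t show "ereal (- 1) * ?y t = ereal r * x t" by (cases "x t") auto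
  qed
  have "inv\<^bsub>add_part S\<^esub> ?y = (\<lambda>t. ereal r * x t)"
  proof (rule inv_unique'[symmetric])
    show "?y \<in> carrier (add_part S)" "(\<lambda>t. ereal r * x t) \<in> carrier (add_part S)"
      using y scale_in_X[OF assms] X_subset_C by (auto simp: add_part_def)
    show "?y \<otimes>\<^bsub>add_part S\<^esub> (\<lambda>t. ereal r * x t) = \<one>\<^bsub>add_part S\<^esub>"
      using upper_sum_neg[OF y] unfolding eq by (simp add: add_part_def)
    then show "(\<lambda>t. ereal r * x t) \<otimes>\<^bsub>add_part S\<^esub> ?y = \<one>\<^bsub>add_part S\<^esub>"
      by (simp add: add_part_def upper_sum_commute)
  qed
  with False show ?thesis by (simp add: invertible_part_def)
qed

section \<open>Distributive laws\<close>

lemma is_lub_meet: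
  assumes A: "A \<subseteq> C" "A \<noteq> {}" and s: "is_lub S s A" and x: "x \<in> C"
  shows "is_lub S (inf s x) ((\<lambda>a. a \<sqinter>\<^bsub>S\<^esub> x) ` A)"
proof -
  have s': "s \<in> C" "\<And>a. a \<in> A \<Longrightarrow> a \<le> s"
    "\<And>w. w \<in> C \<Longrightarrow> (\<And>a. a \<in> A \<Longrightarrow> a \<le> w) \<Longrightarrow> s \<le> w"
    using s A(1) by (auto simp: is_lub_S_iff)
  have img: "(\<lambda>a. a \<sqinter>\<^bsub>S\<^esub> x) ` A = (\<lambda>a. inf a x) ` A"
    using A(1) x by (intro image_cong) (auto simp: meet_S_eq)
  have sub: "(\<lambda>a. inf a x) ` A \<subseteq> C"
    using A(1) x by (auto intro: inf_in_C)
  show ?thesis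
    unfolding img is_lub_S_iff[OF sub]
  proof (intro conjI ballI impI)
    show "inf s x \<in> C" by (intro inf_in_C s' x)
    fix b assume "b \<in> (\<lambda>a. inf a x) ` A"
    then show "b \<le> inf s x" using s'(2) by (auto intro: le_infI1)
  next
    fix u assume "u \<in> C" "\<forall>a\<in>(\<lambda>a. inf a x) ` A. a \<le> u"
    then show "inf s x \<le> u"
      by (intro meet_supremum_le[OF A x _ s'(3,1,2)]) auto
  qed
qed

text \<open>With \<open>s\<close> the common supremum, both sides equal
  \<open>inf s x\<close>.\<close>

lemma sup_meet_cong_S:
  assumes "A \<subseteq> C" "A \<noteq> {}" "B \<subseteq> C" "B \<noteq> {}" "\<Squnion>\<^bsub>S\<^esub>A = \<Squnion>\<^bsub>S\<^esub>B" "x \<in> C"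
  shows "\<Squnion>\<^bsub>S\<^esub>((\<lambda>a. a \<sqinter>\<^bsub>S\<^esub> x) ` A) = \<Squnion>\<^bsub>S\<^esub>((\<lambda>b. b \<sqinter>\<^bsub>S\<^esub> x) ` B)"
proof -
  have sub: "(\<lambda>a. a \<sqinter>\<^bsub>S\<^esub> x) ` D \<subseteq> C" if "D \<subseteq> C" for D
    using that assms(6) by (auto simp: meet_S_eq intro!: inf_in_C)
  obtain s where sA: "is_lub S s A" using lub_S_exists assms(1,2) by blast
  obtain s' where sB: "is_lub S s' B" using lub_S_exists assms(3,4) by blast
  have "s = s'"
    using lub_S_eq[OF assms(1) sA] lub_S_eq[OF assms(3) sB] assms(5) by simp
  with sA sB show ?thesis
    using lub_S_eq[OF sub[OF assms(1)] is_lub_meet[OF assms(1,2) sA assms(6)]]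
      lub_S_eq[OF sub[OF assms(3)] is_lub_meet[OF assms(3,4) sB assms(6)]] by simp
qed

text \<open>Translation by \<open>a t\<close> is monotone on the linearly ordered
  \<open>ereal\<close>, so it commutes with the minimum of two values; density does the
  rest.\<close>

lemma upper_sum_inf_distrib:
  assumes "a \<in> C" "b \<in> C" "x \<in> C"
  shows "upper_sum a (inf x b) = inf (upper_sum a x) (upper_sum a b)"
proof (rule upper_sum_C_eqI)
  show "\<forall>\<^sub>F t in generic. inf (upper_sum a x) (upper_sum a b) t = a t + inf x b t"
    using generic_sum_C[OF assms(1,3)] generic_sum_C[OF assms(1,2)]
  proof eventually_elim
    case (elim t)
    then show ?case
      using add_left_mono[of "x t" "b t" "a t"] add_left_mono[of "b t" "x t" "a t"]
      by (cases "x t" "b t" rule: le_cases) (simp_all add: inf_absorb1 inf_absorb2)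
  qed
qed (intro inf_in_C sum_in_C assms)+

lemma is_lub_invertible_part:
  assumes "a \<in> C"
  shows "is_lub S a {x \<in> X. x \<le> a}"
proof -
  have "{x \<in> X. x \<le> a} \<subseteq> C" using X_subset_C by blast
  then show ?thesis
    using assms C_eq_supremum_X by (auto simp: is_lub_S_iff)
qed

lemma greatest_S: "greatest S (\<lambda>_. \<infinity>) C"
proof -
  have "(\<lambda>_. \<infinity>) \<in> C"
    by (rule C_mono[OF zero_in_C]) (auto simp: le_fun_def)
  then show ?thesis by (auto simp: greatest_def le_fun_def)
qed

section \<open>Verification of the sup-completion axioms\<close>

lemma upper_sum_is_well_defined:
  assumes "u \<in> C" "v \<in> C"
  shows "open (sum_domain u v) \<and> closure (sum_domain u v) = UNIV \<and> (\<exists>!h. is_upper_sum u v h)"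
proof -
  have uv: "u \<in> lower_finite" "v \<in> lower_finite"
    using assms C_lower_finite by auto
  show ?thesis
    by (intro conjI ex_ex1I sum_domain_dense[OF uv] is_upper_sum_unique[OF uv]
        is_upper_sum_exists[OF extremally_disconnected uv])
qed

lemma sup_completion_S: "sup_completion (Cinf_space\<lparr>carrier := X\<rparr>) S"
proof (intro sup_completion.intro sup_completion_axioms.intro order_complete abstract_cone_C
    lattice_S, goal_cases)
  case 1
  show ?case by (simp add: invertible_part_def Units_S)
next
  case 2
  show ?case by (simp add: invertible_part_def Cinf_space_def)
next
  case (3 x y)
  then have "x \<in> Cinf" "y \<in> Cinf"
    using X_subset_Cinf by (auto simp: Cinf_space_def)
  then show ?case
    by (simp add: invertible_part_def Cinf_space_def
        upper_sum_Cinf(2)[OF extremally_disconnected])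
next
  case (4 x r)
  then show ?case by (simp add: scale_invertible_part Cinf_space_def)
next
  case (5 x y)
  show ?case by (simp add: invertible_part_def Cinf_space_def)
next
  case (6 a b c)
  then show ?case by (simp add: upper_sum_mono C_lower_finite)
next
  case (7 a b r)
  then show ?case by (auto simp: le_fun_def intro: ereal_mult_left_mono)
next
  case 8
  show ?case using greatest_S by auto
next
  case (9 x a)
  then have "x \<in> X" "a \<in> C" "a \<le> x"
    by (simp_all add: invertible_part_def Units_S)
  \<comment> \<open>Membership in \<open>C\<close> supplies the lower bound that order convexity
    requires.\<close>
  moreover from this obtain f where "f \<in> X" "f \<le> a"
    by (auto simp: upper_functions_def)
  ultimately have "a \<in> X"
    using C_continuous X_order_convex by blast
  then show ?case by (simp add: invertible_part_def Units_S)
next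
  case (10 A)
  then show ?case using lub_S_exists by simp
next
  case (11 A)
  then show ?case using glb_S_exists by simp
next
  case (12 a)
  then show ?case using is_lub_invertible_part by (simp add: invertible_part_def Units_S)
next
  case (13 a b x)
  then have "a \<in> C" "b \<in> C" "x \<in> C"
    using X_subset_C by (auto simp: invertible_part_def Units_S)
  then show ?case
    by (simp add: meet_S_eq sum_in_C inf_in_C upper_sum_inf_distrib)
next
  case (14 A B x)
  then show ?case
    using X_subset_C by (intro sup_meet_cong_S) (auto simp: invertible_part_def Units_S)
qed

end

theorem theorem1:
  fixes X :: "('k::t2_space \<Rightarrow> ereal) set"
  assumes compact: "compact (UNIV :: 'k set)"
    and extremally_disconnected: "\<And>U :: 'k set. open U \<Longrightarrow> open (closure U)"
    and order_complete: "order_complete_vector_lattice (Cinf_space\<lparr>carrier := X\<rparr>)"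
    and sublattice: "sublattice_of_Cinf X"
    and order_dense: "order_dense_in_Cinf X"
  shows "(\<forall>u\<in>upper_functions X. \<forall>v\<in>upper_functions X.
            open (sum_domain u v) \<and> closure (sum_domain u v) = UNIV \<and>
            (\<exists>!h. is_upper_sum u v h)) \<and>
         sup_completion (Cinf_space\<lparr>carrier := X\<rparr>) (upper_space X)"
proof -
  interpret order_dense_sublattice X
  proof (rule order_dense_sublattice.intro)
    show "\<forall>U :: 'k set. open U \<longrightarrow> open (closure U)"
      by (intro allI impI extremally_disconnected)
  qed (fact order_complete sublattice order_dense)+
  show ?thesis
    by (rule conjI[OF ballI[OF ballI[OF upper_sum_is_well_defined]] sup_completion_S])
qed

end
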